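(* Let $\mathcal M$ be a local Moufang set with basis $(0,\infty)$ satisfying (R1)–(R4), and let $(R,+,\cdot)$ be the structure constructed below from a fixed unit $e$. Then $(R,+,\cdot)$ is a commutative unital ring with identity $e$; it is a local ring whose maximal ideal is $\overline 0$ (the $\sim$-class of $0$); its invertible elements are exactly the units of $\mathcal M$, with $x^{-1}=(-x)\mu_e$; and $2:=e+e$ is invertible in $R$.
   Context: Group actions are right actions; $g^h=h^{-1}gh$. Local Moufang set: $(X,\sim)$ with $|\overline X|>2$ ($\overline x$ class of $x$, $\overline X$ set of classes) and subgroups $U_x$ of the group of equivalence-preserving bijections, such that (LM0) $x\sim y\Rightarrow$ $U_x,U_y$ induce the same group on $\overline X$; (LM1) $U_x$ fixes $x$, sharply transitive on $X\setminus\overline x$; (LM1') the induced group fixes $\overline x$, sharply transitive on $\overline X\setminus\{\overline x\}$; (LM2) $U_x^g=U_{xg}$ for $g\in\langle U_y\rangle$. Basis $(0,\infty)$, $0\not\sim\infty$; $\alpha_x\in U_\infty$ with $0\alpha_x=x$ ($x\not\sim\infty$); $-x=0\alpha_x^{-1}$; $x\cdot k=0\alpha_x^k$; units: $x\not\sim0,\infty$; $\mu_x$: unique element of $U_0\alpha_xU_0$ swapping $0,\infty$; Hua subgroup $H=\langle\mu_x\mu_y\mid x,y\text{ units}\rangle$. Special: $(-(x\tau^{-1}))\tau=-x$ for all units $x$ ($\tau$ any $\mu$-map). Hypotheses: (R1) $\mathcal M$ special; (R2) $U_\infty$ abelian; (R3) $H$ abelian; (R4) $x$ unit $\Rightarrow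 x\cdot2$ unit. Construction: $R:=X\setminus\overline\infty$ with $x+y:=0\alpha_x\alpha_y$; $(R,+)$ is an abelian group in which each $z$ has a unique half $z\cdot\frac12$. Fix a unit $e$, and for units $x$ let $h_x:=\mu_e\mu_x$ (these map $R$ to $R$). For $y\in R$ define $R_y:R\to R$ by: $xR_y=xh_{e+y}-xh_y-x$ if $y,\ y+e$ are units; $xR_y=-xh_{-e+y}+x+xh_y$ if $y$ is a unit and $y+e$ is not; $xR_y=xh_{2e+y}-xh_{e+y}-xh_{-2e}+x$ if $y$ is not a unit (here $2e=e+e$, and all indices occurring are units). Multiplication: $xy:=(xR_y)\cdot\frac12$. *)

theory Defs
  imports "HOL-Algebra.Ring" "HOL-Algebra.Ideal"
begin

text \<open>Permutations of X (the type 'a) are functions 'a => 'a. Group actions are right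
actions: the image of x under g is written g x, and the product gh (first g, then h)
is the function h o g.  The inverse of a bijection g is inv_into UNIV g.\<close>

definition finv :: "('a \<Rightarrow> 'a) \<Rightarrow> ('a \<Rightarrow> 'a)" where
  "finv g = inv_into UNIV g"

definition mcls :: "('a \<Rightarrow> 'a \<Rightarrow> bool) \<Rightarrow> 'a \<Rightarrow> 'a set" where
  "mcls sim x = {y. sim x y}"

definition mclasses :: "('a \<Rightarrow> 'a \<Rightarrow> bool) \<Rightarrow> 'a set set" where
  "mclasses sim = range (mcls sim)"

definition eq_pres_bij :: "('a \<Rightarrow> 'a \<Rightarrow> bool) \<Rightarrow> ('a \<Rightarrow> 'a) \<Rightarrow> bool" where
  "eq_pres_bij sim f \<longleftrightarrow> bij f \<and> (\<forall>x y. sim x y \<longleftrightarrow> sim (f x) (f y))"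

inductive_set gen_group :: "('a \<Rightarrow> 'a) set \<Rightarrow> ('a \<Rightarrow> 'a) set" for S where
  gen_id: "id \<in> gen_group S"
| gen_mult: "g \<in> gen_group S \<Longrightarrow> s \<in> S \<Longrightarrow> s \<circ> g \<in> gen_group S"
| gen_inv: "g \<in> gen_group S \<Longrightarrow> s \<in> S \<Longrightarrow> finv s \<circ> g \<in> gen_group S"

definition is_subgroup_eqb :: "('a \<Rightarrow> 'a \<Rightarrow> bool) \<Rightarrow> ('a \<Rightarrow> 'a) set \<Rightarrow> bool" where
  "is_subgroup_eqb sim G \<longleftrightarrow> (\<forall>f\<in>G. eq_pres_bij sim f) \<and> id \<in> G \<and>
     (\<forall>f\<in>G. \<forall>g\<in>G. g \<circ> f \<in> G) \<and> (\<forall>f\<in>G. finv f \<in> G)"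

definition local_moufang_set :: "('a \<Rightarrow> 'a \<Rightarrow> bool) \<Rightarrow> ('a \<Rightarrow> ('a \<Rightarrow> 'a) set) \<Rightarrow> bool" where
  "local_moufang_set sim U \<longleftrightarrow>
     equivp sim \<and>
     (\<exists>a b c. \<not> sim a b \<and> \<not> sim b c \<and> \<not> sim a c) \<and>
     (\<forall>x. is_subgroup_eqb sim (U x)) \<and>
     \<comment> \<open>(LM0)\<close>
     (\<forall>x y. sim x y \<longrightarrow>
        (\<forall>f\<in>U x. \<exists>g\<in>U y. \<forall>C\<in>mclasses sim. f ` C = g ` C) \<and>
        (\<forall>g\<in>U y. \<exists>f\<in>U x. \<forall>C\<in>mclasses sim. f ` C = g ` C)) \<and>
     \<comment> \<open>(LM1)\<close>
     (\<forall>x. (\<forall>g\<in>U x. g x = x) \<and>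
        (\<forall>y z. y \<notin> mcls sim x \<longrightarrow> z \<notin> mcls sim x \<longrightarrow> (\<exists>!g. g \<in> U x \<and> g y = z))) \<and>
     \<comment> \<open>(LM1')\<close>
     (\<forall>x. (\<forall>g\<in>U x. g ` mcls sim x = mcls sim x) \<and>
        (\<forall>C\<in>mclasses sim. \<forall>D\<in>mclasses sim. C \<noteq> mcls sim x \<longrightarrow> D \<noteq> mcls sim x \<longrightarrow>
           (\<exists>g\<in>U x. g ` C = D) \<and>
           (\<forall>g\<in>U x. \<forall>h\<in>U x. g ` C = D \<longrightarrow> h ` C = D \<longrightarrow>
               (\<forall>E\<in>mclasses sim. g ` E = h ` E)))) \<and>
     \<comment> \<open>(LM2): U_x^g = g^-1 U_x g = U_(xg) for g in the group generated by all root groups\<close>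
     (\<forall>x. \<forall>g\<in>gen_group (\<Union>y. U y). {g \<circ> u \<circ> finv g | u. u \<in> U x} = U (g x))"

context
  fixes sim :: "'a \<Rightarrow> 'a \<Rightarrow> bool" and U :: "'a \<Rightarrow> ('a \<Rightarrow> 'a) set"
    and zero :: 'a and infty :: 'a
begin

definition alpha :: "'a \<Rightarrow> ('a \<Rightarrow> 'a)" where
  "alpha x = (THE g. g \<in> U infty \<and> g zero = x)"

definition neg :: "'a \<Rightarrow> 'a" where
  "neg x = finv (alpha x) zero"

definition munit :: "'a \<Rightarrow> bool" where
  "munit x \<longleftrightarrow> \<not> sim x zero \<and> \<not> sim x infty"

definition mu :: "'a \<Rightarrow> ('a \<Rightarrow> 'a)" where
  "mu x = (THE m. (\<exists>a\<in>U zero. \<exists>b\<in>U zero. m = b \<circ> alpha x \<circ> a) \<and>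
                   m zero = infty \<and> m infty = zero)"

definition hua :: "('a \<Rightarrow> 'a) set" where
  "hua = gen_group {mu y \<circ> mu x | x y. munit x \<and> munit y}"

definition special :: bool where
  "special \<longleftrightarrow> (\<forall>x y. munit x \<longrightarrow> munit y \<longrightarrow> mu y (neg (finv (mu y) x)) = neg x)"

definition Rset :: "'a set" where
  "Rset = {x. \<not> sim x infty}"

definition plus :: "'a \<Rightarrow> 'a \<Rightarrow> 'a" where
  "plus x y = alpha y (alpha x zero)"

definition minus :: "'a \<Rightarrow> 'a \<Rightarrow> 'a" where
  "minus x y = plus x (neg y)"

definition half :: "'a \<Rightarrow> 'a" where
  "half z = (THE w. \<not> sim w infty \<and> plus w w = z)"

definition hmap :: "'a \<Rightarrow> 'a \<Rightarrow> ('a \<Rightarrow> 'a)" where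
  "hmap e x = mu x \<circ> mu e"

definition Rop :: "'a \<Rightarrow> 'a \<Rightarrow> 'a \<Rightarrow> 'a" where
  "Rop e y x =
     (if munit y \<and> munit (plus y e) then
        minus (minus (hmap e (plus e y) x) (hmap e y x)) x
      else if munit y then
        plus (plus (neg (hmap e (plus (neg e) y) x)) x) (hmap e y x)
      else
        plus (minus (minus (hmap e (plus (plus e e) y) x) (hmap e (plus e y) x))
                    (hmap e (neg (plus e e)) x)) x)"

definition rmult :: "'a \<Rightarrow> 'a \<Rightarrow> 'a \<Rightarrow> 'a" where
  "rmult e x y = half (Rop e y x)"

definition the_ring :: "'a \<Rightarrow> 'a ring" where
  "the_ring e = \<lparr>carrier = Rset, mult = rmult e, one = e, zero = zero, add = plus\<rparr>"

end

definition local_ring_with_max :: "('a, 'b) ring_scheme \<Rightarrow> 'a set \<Rightarrow> bool" where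
  "local_ring_with_max R M \<longleftrightarrow> cring R \<and> maximalideal M R \<and>
     (\<forall>I. maximalideal I R \<longrightarrow> I = M)"

end

theory Submission
  imports Defs
begin

text \<open>Commutativity of the Hua subgroup forces the maps \<open>\<mu>\<^sub>x\<close> to be involutions, because
  \<open>\<mu>\<^sub>b\<^sup>2\<close> centralizes every \<open>\<mu>\<^sub>a\<close>, and a unit \<open>a\<close> with \<open>2a\<close> a unit is determined up to sign by
  \<open>\<mu>\<^sub>a\<close>. The operators \<open>h\<^sub>x\<close> generate, together with halving, a commutative ring of additive maps
  containing every \<open>L\<^sub>y = R\<^sub>y/2\<close>. The exchange identity
  \<open>(a+b)\<mu>\<^sub>a + a = (a+b)\<mu>\<^sub>b + b\<close> gives \<open>eL\<^sub>y = y\<close>. Hence \<open>xy = xL\<^sub>y = eL\<^sub>xL\<^sub>y\<close> is commutative and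
  associative, and all operators are linear over this multiplication. Finally the same
  identity gives \<open>x\<^sup>2 = eh\<^sub>x\<close>; since \<open>w = (-x)\<mu>\<^sub>e\<close> satisfies \<open>wh\<^sub>x = x\<close>, linearity yields
  \<open>(wx)h\<^sub>x = x\<^sup>2 = eh\<^sub>x\<close>, that is \<open>wx = e\<close>.\<close>

section \<open>Groups generated by a set of permutations\<close>

lemma gen_group_incl: "s \<in> S \<Longrightarrow> s \<in> gen_group S"
  using gen_group.gen_mult[OF gen_group.gen_id] by fastforce

lemma gen_group_comp:
  assumes "g \<in> gen_group S" and "f \<in> gen_group S"
  shows "g \<circ> f \<in> gen_group S"
  using assms(1)
proof induction
  case gen_id
  show ?case by (metis assms(2) id_comp)
qed (metis gen_group.gen_mult gen_group.gen_inv comp_assoc)+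

lemma finv_apply [simp]: "bij g \<Longrightarrow> finv g (g x) = x" "bij g \<Longrightarrow> g (finv g x) = x"
  by (simp_all add: finv_def bij_is_inj bij_is_surj surj_f_inv_f)

lemma bij_finv: "bij g \<Longrightarrow> bij (finv g)"
  by (simp add: finv_def bij_imp_bij_inv)

lemma finv_comp: "bij g \<Longrightarrow> bij f \<Longrightarrow> finv (g \<circ> f) = finv f \<circ> finv g"
  by (simp add: finv_def o_inv_distrib)

lemma finv_finv: "bij g \<Longrightarrow> finv (finv g) = g"
  by (simp add: finv_def inv_inv_eq)

text \<open>Bijectivity is carried through the induction because \<open>finv\<close> reverses a
  composite only for bijections. The new factor of the inverse lands on the right, while the
  introduction rules of \<open>gen_group\<close> multiply on the left; hence
  \<open>gen_group_comp\<close>.\<close>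

lemma gen_group_finv:
  assumes bij: "\<And>s. s \<in> S \<Longrightarrow> bij s" and "g \<in> gen_group S"
  shows "bij g \<and> finv g \<in> gen_group S"
  using assms(2)
proof induction
  case gen_id
  then show ?case using gen_group.gen_id[of S] by (simp add: finv_def flip: id_def)
next
  case (gen_mult g s)
  have s: "bij s" "finv s \<in> gen_group S"
    using gen_mult.hyps bij gen_group.gen_inv[OF gen_group.gen_id, of s S] by auto
  show ?case
    using gen_mult.IH gen_group_comp[of "finv g" S "finv s"] s finv_comp[of s g] bij_comp[of g s]
    by metis
next
  case (gen_inv g s)
  have s: "bij s" "s \<in> gen_group S"
    using gen_inv.hyps bij gen_group_incl by auto
  show ?case
    using gen_inv.IH gen_group_comp[of "finv g" S s] s finv_comp[of "finv s" g]
      bij_comp[of g "finv s"] bij_finv[OF s(1)] finv_finv[OF s(1)]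
    by metis
qed

section \<open>Root groups and the group they generate\<close>

locale local_moufang =
  fixes sim :: "'a \<Rightarrow> 'a \<Rightarrow> bool" and U :: "'a \<Rightarrow> ('a \<Rightarrow> 'a) set"
    and zero infty :: 'a
  assumes LM: "local_moufang_set sim U"
    and basis: "\<not> sim zero infty"
begin

abbreviation "\<alpha> \<equiv> alpha U zero infty"
abbreviation "\<mu> \<equiv> mu U zero infty"
abbreviation "ng \<equiv> neg U zero infty"
abbreviation pls (infixl "\<boxplus>" 65) where "x \<boxplus> y \<equiv> plus U zero infty x y"
abbreviation "unit \<equiv> munit sim zero infty"
abbreviation "R \<equiv> Rset sim infty"
abbreviation "little \<equiv> gen_group (\<Union>y. U y)"

lemma LM_parts:
  shows LM_equivp: "equivp sim"
    and LM_subgroup: "\<forall>x. is_subgroup_eqb sim (U x)"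
    and LM1: "\<forall>x. (\<forall>g\<in>U x. g x = x) \<and>
      (\<forall>y z. y \<notin> mcls sim x \<longrightarrow> z \<notin> mcls sim x \<longrightarrow> (\<exists>!g. g \<in> U x \<and> g y = z))"
    and LM2: "\<forall>x. \<forall>g\<in>gen_group (\<Union>y. U y). {g \<circ> u \<circ> finv g | u. u \<in> U x} = U (g x)"
  using LM unfolding local_moufang_set_def by - (elim conjE, assumption)+

lemma sim_refl [simp]: "sim x x"
  and sim_sym: "sim x y \<Longrightarrow> sim y x"
  and sim_trans: "sim x y \<Longrightarrow> sim y z \<Longrightarrow> sim x z"
  using LM_equivp by (auto intro: equivp_reflp elim: equivp_symp equivp_transp)

lemma U_eqb: "f \<in> U x \<Longrightarrow> eq_pres_bij sim f"
  and U_id: "id \<in> U x"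
  and U_comp: "f \<in> U x \<Longrightarrow> g \<in> U x \<Longrightarrow> g \<circ> f \<in> U x"
  and U_finv: "f \<in> U x \<Longrightarrow> finv f \<in> U x"
  using LM_subgroup unfolding is_subgroup_eqb_def by blast+

lemma U_bij: "f \<in> U x \<Longrightarrow> bij f"
  and U_sim: "f \<in> U x \<Longrightarrow> sim (f y) (f z) \<longleftrightarrow> sim y z"
  using U_eqb unfolding eq_pres_bij_def by blast+

lemma U_fix: "g \<in> U x \<Longrightarrow> g x = x"
  using LM1 by blast

lemma U_ex1:
  assumes "\<not> sim x y" "\<not> sim x z"
  shows "\<exists>!g. g \<in> U x \<and> g y = z"
  using LM1 assms unfolding mcls_def by blast

lemma U_unique:
  assumes "g \<in> U x" "h \<in> U x" "g y = h y" "\<not> sim x y"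
  shows "g = h"
  using U_ex1[of x y "g y"] assms U_sim[of g x x y] U_fix[of g x] by metis

lemma U_conj:
  assumes "g \<in> little" "u \<in> U x"
  shows "g \<circ> u \<circ> finv g \<in> U (g x)"
proof -
  have "{g \<circ> u \<circ> finv g | u. u \<in> U x} = U (g x)"
    using LM2 assms(1) by blast
  with assms(2) show ?thesis by blast
qed

lemma U_little: "u \<in> U x \<Longrightarrow> u \<in> little"
  by (auto intro: gen_group_incl)

lemma little_bij: "g \<in> little \<Longrightarrow> bij g"
  and little_finv: "g \<in> little \<Longrightarrow> finv g \<in> little"
  using gen_group_finv[of "\<Union>y. U y"] U_bij by blast+

lemma little_sim: "g \<in> little \<Longrightarrow> sim (g x) (g y) \<longleftrightarrow> sim x y"
proof (induction arbitrary: x y rule: gen_group.induct)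
  case (gen_mult g s)
  then show ?case using U_sim by auto
next
  case (gen_inv g s)
  then obtain w where "s \<in> U w" by auto
  then show ?case using gen_inv.IH U_sim[OF U_finv] by auto
qed auto

lemma R_iff: "x \<in> R \<longleftrightarrow> \<not> sim x infty"
  by (simp add: Rset_def)

lemma zero_R [simp]: "zero \<in> R"
  using basis R_iff by simp

section \<open>The addition on \<open>R\<close> induced by \<open>U infty\<close>\<close>

lemma alpha:
  assumes "x \<in> R"
  shows "\<alpha> x \<in> U infty" and "\<alpha> x zero = x"
proof -
  have "\<exists>!g. g \<in> U infty \<and> g zero = x"
    using U_ex1[of infty zero x] basis assms sim_sym unfolding R_iff by blast
  from theI'[OF this] show "\<alpha> x \<in> U infty" "\<alpha> x zero = x"
    unfolding alpha_def by auto
qed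

lemma U_infty_R: "g \<in> U infty \<Longrightarrow> g x \<in> R \<longleftrightarrow> x \<in> R"
  using U_sim[of g infty x infty] U_fix[of g infty] unfolding R_iff by simp

lemma alpha_eqI: "g \<in> U infty \<Longrightarrow> g zero = x \<Longrightarrow> \<alpha> x = g"
  using U_unique[of "\<alpha> x" infty g zero] alpha[of x] basis sim_sym U_infty_R[of g zero] by auto

lemma alpha_bij: "x \<in> R \<Longrightarrow> bij (\<alpha> x)"
  using alpha U_bij by blast

lemma alpha_zero: "\<alpha> zero = id"
  by (rule alpha_eqI) (auto simp: U_id)

lemma neg_R [simp]: "x \<in> R \<Longrightarrow> ng x \<in> R"
  unfolding neg_def using U_infty_R[OF U_finv[OF alpha(1)]] by simp

lemma alpha_neg: "x \<in> R \<Longrightarrow> \<alpha> (ng x) = finv (\<alpha> x)"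
  by (rule alpha_eqI) (auto simp: U_finv alpha neg_def)

lemma plus_alpha: "x \<in> R \<Longrightarrow> x \<boxplus> y = \<alpha> y x"
  unfolding plus_def by (simp add: alpha)

lemma plus_R [simp]: "x \<in> R \<Longrightarrow> y \<in> R \<Longrightarrow> x \<boxplus> y \<in> R"
  by (simp add: plus_alpha U_infty_R[OF alpha(1)])

lemma alpha_plus: "x \<in> R \<Longrightarrow> y \<in> R \<Longrightarrow> \<alpha> (x \<boxplus> y) = \<alpha> y \<circ> \<alpha> x"
  by (rule alpha_eqI) (auto simp: alpha plus_def intro: U_comp)

lemma plus_assoc: "x \<in> R \<Longrightarrow> y \<in> R \<Longrightarrow> z \<in> R \<Longrightarrow> (x \<boxplus> y) \<boxplus> z = x \<boxplus> (y \<boxplus> z)"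
  using plus_alpha[of "x \<boxplus> y" z] plus_alpha[of x y] plus_alpha[of x "y \<boxplus> z"] alpha_plus[of y z] plus_R[of x y]
  by simp

lemma plus_zero [simp]: "x \<in> R \<Longrightarrow> x \<boxplus> zero = x" "x \<in> R \<Longrightarrow> zero \<boxplus> x = x"
  by (simp_all add: plus_alpha alpha_zero alpha)

lemma plus_neg: "x \<in> R \<Longrightarrow> x \<boxplus> ng x = zero"
  using finv_apply(1)[OF alpha_bij, of x zero] by (simp add: plus_alpha alpha_neg alpha)

lemma plus_neg_left: "x \<in> R \<Longrightarrow> ng x \<boxplus> x = zero"
  using plus_alpha[of "ng x" x] neg_R[of x] by (simp add: neg_def alpha_bij)

lemma unit_R [simp]: "unit x \<Longrightarrow> x \<in> R"
  by (simp add: munit_def R_iff)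

lemma unit_iff: "x \<in> R \<Longrightarrow> unit x \<longleftrightarrow> \<not> sim x zero"
  by (simp add: munit_def R_iff)

lemma plus_sim: "x \<in> R \<Longrightarrow> y \<in> R \<Longrightarrow> z \<in> R \<Longrightarrow> sim (x \<boxplus> z) (y \<boxplus> z) \<longleftrightarrow> sim x y"
  by (simp add: plus_alpha U_sim[OF alpha(1)])

lemma unit_neg: "unit x \<Longrightarrow> unit (ng x)"
  using plus_sim[of "ng x" zero x] sim_sym[of zero x] unit_iff[of x] unit_iff[of "ng x"]
  by (auto simp: plus_neg_left)

lemma sim_R: "sim x y \<Longrightarrow> x \<in> R \<longleftrightarrow> y \<in> R"
  unfolding R_iff using sim_sym sim_trans by blast

lemma sim_unit: "sim x y \<Longrightarrow> unit x \<longleftrightarrow> unit y"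
  unfolding munit_def using sim_sym sim_trans by blast

section \<open>The maps \<open>\<mu> x\<close>\<close>

text \<open>The swap forces \<open>b\<close> to send \<open>x\<close> to \<open>infty\<close> and
  \<open>a\<close> to send \<open>infty\<close> to \<open>ng x\<close>; sharp transitivity of
  \<open>U zero\<close> supplies exactly one of each.\<close>

lemma mu_ex1:
  assumes "unit x"
  shows "\<exists>!m. (\<exists>a\<in>U zero. \<exists>b\<in>U zero. m = b \<circ> \<alpha> x \<circ> a) \<and> m zero = infty \<and> m infty = zero"
proof -
  have x: "x \<in> R" "\<not> sim zero x" and nx: "\<not> sim zero (ng x)"
    using assms unit_neg[OF assms] sim_sym unfolding munit_def R_iff by blast+
  obtain a where a: "a \<in> U zero" "a infty = ng x"
    using U_ex1[OF basis nx] by blast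
  obtain b where b: "b \<in> U zero" "b x = infty"
    using U_ex1[OF x(2) basis] by blast
  have inv: "\<alpha> x (ng x) = zero"
    using x(1) by (simp add: neg_def alpha_bij)
  show ?thesis
  proof (rule ex1I[of _ "b \<circ> \<alpha> x \<circ> a"])
    show "(\<exists>a'\<in>U zero. \<exists>b'\<in>U zero. b \<circ> \<alpha> x \<circ> a = b' \<circ> \<alpha> x \<circ> a') \<and>
        (b \<circ> \<alpha> x \<circ> a) zero = infty \<and> (b \<circ> \<alpha> x \<circ> a) infty = zero"
      using a b inv U_fix[OF a(1)] U_fix[OF b(1)] alpha[OF x(1)] by auto
  next
    fix m
    assume m: "(\<exists>a\<in>U zero. \<exists>b\<in>U zero. m = b \<circ> \<alpha> x \<circ> a) \<and> m zero = infty \<and> m infty = zero"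
    then obtain a' b' where a': "a' \<in> U zero" and b': "b' \<in> U zero" and me: "m = b' \<circ> \<alpha> x \<circ> a'"
      by blast
    have "b' x = infty"
      using m me U_fix[OF a'] alpha[OF x(1)] by auto
    then have "b' = b"
      using U_unique[OF b' b(1), of x] b(2) x(2) by auto
    have "b' (\<alpha> x (a' infty)) = b' zero"
      using m me U_fix[OF b'] by auto
    then have "\<alpha> x (a' infty) = \<alpha> x (ng x)"
      using U_bij[OF b'] inv by (metis finv_apply(1))
    then have "a' infty = ng x"
      using alpha_bij[OF x(1)] by (metis finv_apply(1))
    then have "a' = a"
      using U_unique[OF a' a(1), of infty] a(2) basis by auto
    with \<open>b' = b\<close> me show "m = b \<circ> \<alpha> x \<circ> a" by simp
  qed
qed

lemma mu:
  assumes "unit x"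
  obtains a b where "a \<in> U zero" "b \<in> U zero" "\<mu> x = b \<circ> \<alpha> x \<circ> a"
  using theI'[OF mu_ex1[OF assms]] unfolding mu_def by blast

lemma mu_swap [simp]:
  assumes "unit x"
  shows "\<mu> x zero = infty" "\<mu> x infty = zero"
  using theI'[OF mu_ex1[OF assms]] unfolding mu_def by auto

lemma mu_eqI:
  assumes "unit x" "a \<in> U zero" "b \<in> U zero" "m = b \<circ> \<alpha> x \<circ> a" "m zero = infty" "m infty = zero"
  shows "\<mu> x = m"
  unfolding mu_def by (rule the1_equality[OF mu_ex1]) (use assms in auto)

lemma mu_little: "unit x \<Longrightarrow> \<mu> x \<in> little"
  by (metis mu U_little gen_group_comp alpha(1) unit_R)

lemma mu_bij: "unit x \<Longrightarrow> bij (\<mu> x)"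
  using mu_little little_bij by blast

lemma mu_sim: "unit x \<Longrightarrow> sim (\<mu> x y) (\<mu> x z) \<longleftrightarrow> sim y z"
  using mu_little little_sim by blast

lemma mu_unit: "unit x \<Longrightarrow> unit y \<Longrightarrow> unit (\<mu> x y)"
  using mu_sim[of x y zero] mu_sim[of x y infty] by (auto simp: munit_def)

text \<open>Inverting \<open>b \<circ> \<alpha> x \<circ> a\<close> gives a product of the same
  shape with \<open>\<alpha> (ng x)\<close> in the middle, and it still swaps the basis.\<close>

lemma mu_neg:
  assumes "unit x"
  shows "\<mu> (ng x) = finv (\<mu> x)"
proof -
  obtain a b where ab: "a \<in> U zero" "b \<in> U zero" "\<mu> x = b \<circ> \<alpha> x \<circ> a"
    using mu[OF assms] .
  note bijs = U_bij[OF ab(1)] U_bij[OF ab(2)] alpha_bij[OF unit_R[OF assms]]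
  have "finv (\<mu> x) = finv a \<circ> \<alpha> (ng x) \<circ> finv b"
    using bijs by (simp add: ab(3) finv_comp bij_comp alpha_neg assms comp_assoc)
  moreover have "finv (\<mu> x) zero = infty" "finv (\<mu> x) infty = zero"
    using mu_swap[OF assms] finv_apply(1)[OF mu_bij[OF assms]] by metis+
  ultimately show ?thesis
    using mu_eqI[OF unit_neg[OF assms] U_finv[OF ab(2)] U_finv[OF ab(1)]] by metis
qed

section \<open>The stabilizer of the basis\<close>

text \<open>The two-point stabilizer in the group generated by all root groups. It contains every
  product \<open>\<mu> x \<circ> \<mu> y\<close>. By (LM2) its elements normalize
  \<open>U zero\<close> and \<open>U infty\<close>, so they respect addition and permute the maps
  \<open>\<mu> x\<close> by conjugation.\<close>

definition torus :: "('a \<Rightarrow> 'a) set" where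
  "torus = {h \<in> little. h zero = zero \<and> h infty = infty}"

lemma torusD: "h \<in> torus \<Longrightarrow> h \<in> little" "h \<in> torus \<Longrightarrow> h zero = zero" "h \<in> torus \<Longrightarrow> h infty = infty"
  "h \<in> torus \<Longrightarrow> bij h"
  unfolding torus_def using little_bij by auto

lemma torus_finv: 
  assumes "h \<in> torus"
  shows "finv h zero = zero" "finv h infty = infty"
  using torusD[OF assms] finv_apply(1) by metis+

lemma torus_R: "h \<in> torus \<Longrightarrow> h x \<in> R \<longleftrightarrow> x \<in> R"
  using little_sim[of h x infty] unfolding R_iff torus_def by simp

lemma torus_sim: "h \<in> torus \<Longrightarrow> sim (h x) zero \<longleftrightarrow> sim x zero"
  using little_sim[of h x zero] unfolding torus_def by simp

lemma torus_unit: "h \<in> torus \<Longrightarrow> unit (h x) \<longleftrightarrow> unit x"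
  using torus_R torus_sim unfolding munit_def R_iff by blast

lemma alpha_torus:
  assumes h: "h \<in> torus" and "x \<in> R"
  shows "\<alpha> (h x) = h \<circ> \<alpha> x \<circ> finv h"
  using U_conj[OF torusD(1)[OF h] alpha(1)[OF assms(2)]]
  by (intro alpha_eqI) (auto simp: torusD[OF h] torus_finv[OF h] alpha assms(2))

lemma torus_add:
  assumes h: "h \<in> torus" and "x \<in> R" "y \<in> R"
  shows "h (x \<boxplus> y) = h x \<boxplus> h y"
  using assms torusD(4)[OF h]
  by (simp add: plus_alpha[of "h x"] torus_R alpha_torus plus_alpha)

lemma mu_torus:
  assumes h: "h \<in> torus" and x: "unit x"
  shows "\<mu> (h x) = h \<circ> \<mu> x \<circ> finv h"
proof -
  obtain a b where ab: "a \<in> U zero" "b \<in> U zero" "\<mu> x = b \<circ> \<alpha> x \<circ> a"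
    using mu[OF x] .
  have ab': "h \<circ> a \<circ> finv h \<in> U zero" "h \<circ> b \<circ> finv h \<in> U zero"
    using U_conj[OF torusD(1)[OF h]] ab torusD(2)[OF h] by metis+
  show ?thesis
  proof (rule mu_eqI[OF _ ab'])
    show "h \<circ> \<mu> x \<circ> finv h = h \<circ> b \<circ> finv h \<circ> \<alpha> (h x) \<circ> (h \<circ> a \<circ> finv h)"
      by (simp add: fun_eq_iff ab(3) alpha_torus[OF h] x torusD[OF h])
  qed (use x h in \<open>auto simp: torus_unit torusD torus_finv\<close>)
qed

lemma mu_mu_torus: "unit x \<Longrightarrow> unit y \<Longrightarrow> \<mu> x \<circ> \<mu> y \<in> torus"
  by (auto simp: torus_def mu_little gen_group_comp)

text \<open>Starting from \<open>\<mu> a = d \<circ> \<alpha> a \<circ> c\<close>, the inverse is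
  rewritten with a single factor in \<open>U zero\<close>: conjugation by \<open>\<mu> a\<close>
  moves \<open>finv c\<close> into \<open>U infty\<close>.\<close>

lemma mu_decomposition:
  assumes "unit a"
  obtains g u where "g \<in> U zero" "g infty = a" "u \<in> U infty" "\<mu> (ng a) = \<alpha> (ng a) \<circ> g \<circ> u"
proof -
  obtain c d where cd: "c \<in> U zero" "d \<in> U zero" "\<mu> a = d \<circ> \<alpha> a \<circ> c"
    using mu[OF assms] .
  note m = mu_bij[OF assms] mu_swap[OF assms]
  define g where "g = finv d"
  define u where "u = \<mu> a \<circ> finv c \<circ> finv (\<mu> a)"
  have "d a = infty"
    using m(2) cd U_fix[OF cd(1)] alpha[OF unit_R[OF assms]] by simp
  then have "g infty = a"
    using finv_apply(1)[OF U_bij[OF cd(2)], of a] by (simp add: g_def)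
  moreover have "u \<in> U infty"
    using U_conj[OF mu_little[OF assms] U_finv[OF cd(1)]] m by (simp add: u_def)
  moreover have "\<mu> (ng a) = \<alpha> (ng a) \<circ> g \<circ> u"
  proof
    fix x
    define v where "v = finv c (finv (\<mu> a) x)"
    have "c v = finv (\<mu> a) x"
      using U_bij[OF cd(1)] by (simp add: v_def)
    moreover have "\<mu> a v = d (\<alpha> a (c v))"
      using cd(3) by simp
    ultimately show "\<mu> (ng a) x = (\<alpha> (ng a) \<circ> g \<circ> u) x"
      using U_bij[OF cd(2)] alpha_bij[of a] assms
      by (simp add: mu_neg alpha_neg u_def g_def v_def)
  qed
  ultimately show ?thesis
    using that[of g u] U_finv[OF cd(2)] by (simp add: g_def)
qed

end

section \<open>Special local Moufang sets with commutative root and Hua groups\<close>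

locale commutative_moufang = local_moufang +
  fixes e :: 'a
  assumes R1: "special sim U zero infty"
    and R2: "\<forall>f\<in>U infty. \<forall>g\<in>U infty. f \<circ> g = g \<circ> f"
    and R3: "\<forall>f\<in>hua sim U zero infty. \<forall>g\<in>hua sim U zero infty. f \<circ> g = g \<circ> f"
    and R4: "unit x \<Longrightarrow> unit (x \<boxplus> x)"
    and e_unit [simp]: "unit e"
begin

section \<open>Arithmetic of the abelian group \<open>R\<close>\<close>

abbreviation mns (infixl "\<boxminus>" 65) where "x \<boxminus> y \<equiv> minus U zero infty x y"

lemma plus_comm: "x \<in> R \<Longrightarrow> y \<in> R \<Longrightarrow> x \<boxplus> y = y \<boxplus> x"
  using R2 alpha(1)[of x] alpha(1)[of y] alpha(2)[of x] alpha(2)[of y]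
  unfolding plus_def by (metis o_apply)

lemma plus_left_comm: "x \<in> R \<Longrightarrow> y \<in> R \<Longrightarrow> z \<in> R \<Longrightarrow> x \<boxplus> (y \<boxplus> z) = y \<boxplus> (x \<boxplus> z)"
  using plus_assoc plus_comm by metis

lemmas plus_ac = plus_assoc plus_comm plus_left_comm

lemma minus_R [simp]: "x \<in> R \<Longrightarrow> y \<in> R \<Longrightarrow> x \<boxminus> y \<in> R"
  by (simp add: minus_def)

lemma minus_eq_iff: 
  assumes "x \<in> R" "y \<in> R" "z \<in> R"
  shows "x \<boxminus> y = z \<longleftrightarrow> x = z \<boxplus> y"
  using assms plus_assoc[of x "ng y" y] plus_assoc[of z y "ng y"]
  unfolding minus_def by (auto simp: plus_neg plus_neg_left)

lemma eq_minus_iff: "x \<in> R \<Longrightarrow> y \<in> R \<Longrightarrow> z \<in> R \<Longrightarrow> z = x \<boxminus> y \<longleftrightarrow> z \<boxplus> y = x"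
  using minus_eq_iff by metis

lemma plus_minus: "x \<in> R \<Longrightarrow> y \<in> R \<Longrightarrow> z \<in> R \<Longrightarrow> x \<boxplus> (y \<boxminus> z) = (x \<boxplus> y) \<boxminus> z"
  unfolding minus_def by (simp add: plus_assoc)

lemma minus_plus: "x \<in> R \<Longrightarrow> y \<in> R \<Longrightarrow> z \<in> R \<Longrightarrow> (x \<boxminus> y) \<boxplus> z = (x \<boxplus> z) \<boxminus> y"
  unfolding minus_def by (simp add: plus_ac)

lemma plus_cancel: "x \<in> R \<Longrightarrow> y \<in> R \<Longrightarrow> z \<in> R \<Longrightarrow> x \<boxplus> z = y \<boxplus> z \<longleftrightarrow> x = y"
  using minus_eq_iff by (metis plus_R)

lemma plus_cancel_left: "x \<in> R \<Longrightarrow> y \<in> R \<Longrightarrow> z \<in> R \<Longrightarrow> z \<boxplus> x = z \<boxplus> y \<longleftrightarrow> x = y"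
  using plus_cancel plus_comm by metis

lemma neg_eqI: "x \<in> R \<Longrightarrow> y \<in> R \<Longrightarrow> x \<boxplus> y = zero \<Longrightarrow> y = ng x"
  using plus_cancel[of y "ng x" x] plus_neg_left[of x] plus_comm[of x y] by simp

lemma neg_neg [simp]: "x \<in> R \<Longrightarrow> ng (ng x) = x"
  using neg_eqI[of "ng x" x] by (simp add: plus_neg_left)

lemma neg_plus: "x \<in> R \<Longrightarrow> y \<in> R \<Longrightarrow> ng (x \<boxplus> y) = ng x \<boxminus> y"
proof (rule neg_eqI[symmetric])
  assume "x \<in> R" "y \<in> R"
  moreover from this have "(x \<boxplus> y) \<boxplus> (ng x \<boxplus> ng y) = (x \<boxplus> ng x) \<boxplus> (y \<boxplus> ng y)"
    by (simp add: plus_ac)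
  ultimately show "(x \<boxplus> y) \<boxplus> (ng x \<boxminus> y) = zero"
    by (simp add: minus_def plus_neg)
qed simp_all

lemma minus_minus: "x \<in> R \<Longrightarrow> y \<in> R \<Longrightarrow> z \<in> R \<Longrightarrow> (x \<boxminus> y) \<boxminus> z = x \<boxminus> (y \<boxplus> z)"
  by (simp add: minus_def neg_plus plus_assoc)

lemma minus_neg: "x \<in> R \<Longrightarrow> y \<in> R \<Longrightarrow> x \<boxminus> ng y = x \<boxplus> y"
  by (simp add: minus_def)

lemma neg_plus_left: "x \<in> R \<Longrightarrow> y \<in> R \<Longrightarrow> ng x \<boxplus> y = y \<boxminus> x"
  by (simp add: minus_def plus_comm)

lemma plus_neg_right: "x \<in> R \<Longrightarrow> y \<in> R \<Longrightarrow> y \<boxplus> ng x = y \<boxminus> x"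
  by (simp add: minus_def)

lemma neg_eq_iff: "x \<in> R \<Longrightarrow> y \<in> R \<Longrightarrow> ng x = y \<longleftrightarrow> x \<boxplus> y = zero"
  using neg_eqI plus_neg by metis

lemma eq_neg_iff: "x \<in> R \<Longrightarrow> y \<in> R \<Longrightarrow> y = ng x \<longleftrightarrow> x \<boxplus> y = zero"
  using neg_eqI plus_neg by metis

text \<open>These clear subtractions and negatives from an equation, so that \<open>plus_ac\<close>
  can finish.\<close>

lemmas diff_simps = minus_eq_iff eq_minus_iff plus_minus minus_plus minus_minus minus_neg
  neg_plus_left plus_neg_right neg_eq_iff eq_neg_iff

lemma plus_sim_right: "x \<in> R \<Longrightarrow> y \<in> R \<Longrightarrow> z \<in> R \<Longrightarrow> sim (z \<boxplus> x) (z \<boxplus> y) \<longleftrightarrow> sim x y"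
  by (simp add: plus_comm[of z] plus_sim)

lemma minus_sim_zero: "x \<in> R \<Longrightarrow> y \<in> R \<Longrightarrow> sim (x \<boxminus> y) zero \<longleftrightarrow> sim x y"
  using plus_sim[of "x \<boxminus> y" zero y] by (simp add: minus_def plus_assoc plus_neg_left)

lemma plus_sim_zero: "x \<in> R \<Longrightarrow> y \<in> R \<Longrightarrow> sim (x \<boxplus> y) zero \<longleftrightarrow> sim x (ng y)"
  using minus_sim_zero[of x "ng y"] by (simp add: minus_neg)

lemma unit_plus_nonunit: "unit x \<Longrightarrow> sim y zero \<Longrightarrow> unit (x \<boxplus> y)"
  using plus_sim_right[of y zero x] sim_R[of y zero] sim_unit by auto

text \<open>Otherwise \<open>x\<close> would be equivalent to both \<open>ng y\<close> and
  \<open>y\<close>, and \<open>y \<boxplus> y\<close> would be a nonunit, against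
  \<open>R4\<close>.\<close>

lemma unit_minus:
  assumes x: "unit x" and y: "unit y" and "\<not> unit (x \<boxplus> y)"
  shows "unit (x \<boxminus> y)"
proof -
  have "sim x (ng y)"
    using assms plus_sim_zero[of x y] unit_iff[of "x \<boxplus> y"] by simp
  moreover have "\<not> sim y (ng y)"
    using R4[OF y] y plus_sim_zero[of y y] unit_iff[of "y \<boxplus> y"] by simp
  ultimately have "\<not> sim x y"
    using sim_sym sim_trans by blast
  then show ?thesis
    using x y minus_sim_zero[of x y] unit_iff[of "x \<boxminus> y"] by simp
qed

section \<open>Specialness and the exchange identity\<close>

text \<open>This is \<open>special\<close> evaluated at \<open>\<mu> y x\<close> in place of
  \<open>x\<close>.\<close>

lemma mu_ng: "unit x \<Longrightarrow> unit y \<Longrightarrow> \<mu> y (ng x) = ng (\<mu> y x)"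
  using R1 mu_unit[of y x] mu_bij[of y] unfolding special_def by (metis finv_apply(1))

lemma mu_ng_inverse [simp]:
  assumes "unit y"
  shows "\<mu> (ng y) (\<mu> y x) = x" "\<mu> y (\<mu> (ng y) x) = x"
  using assms by (simp_all add: mu_neg mu_bij)

text \<open>Both sides are the value at \<open>x\<close> of the element of \<open>U\<^sub>0\<close> mapping \<open>\<infinity>\<close> to \<open>a\<close>. The left-hand
  side does not see which of \<open>a\<close>, \<open>x\<close> plays which role, whence the exchange identity below.\<close>
lemma special_decomposition:
  assumes a: "unit a" and y: "unit y"
  shows "\<mu> y (\<alpha> (\<mu> (ng y) a) (\<mu> (ng y) x)) = \<alpha> a (\<mu> (ng a) (\<alpha> a x))"
proof -
  obtain g u where g: "g \<in> U zero" "g infty = a" and u: "u \<in> U infty"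
    and dec: "\<mu> (ng a) = \<alpha> (ng a) \<circ> g \<circ> u"
    using mu_decomposition[OF a] .
  define b where "b = \<mu> (ng y) a"
  have b: "unit b" "\<mu> y b = a"
    using a y by (auto simp: b_def mu_unit unit_neg)
  \<comment> \<open>Conjugation by \<open>\<mu> y\<close> carries \<open>U infty\<close> to
    \<open>U zero\<close>, and the conjugate sends \<open>infty\<close> to \<open>a\<close> just as
    \<open>g\<close> does, so the two coincide.\<close>
  have "\<mu> y \<circ> \<alpha> b \<circ> \<mu> (ng y) \<in> U zero"
    using U_conj[OF mu_little[OF y] alpha(1)[of b]] b y by (simp add: mu_neg)
  moreover have "(\<mu> y \<circ> \<alpha> b \<circ> \<mu> (ng y)) infty = g infty"
    using b y g by (simp add: unit_neg alpha)
  ultimately have g_eq: "\<mu> y \<circ> \<alpha> b \<circ> \<mu> (ng y) = g"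
    using U_unique[OF _ g(1)] basis by blast
  \<comment> \<open>The value at \<open>zero\<close> identifies \<open>u\<close>: since
    \<open>g\<close> sends \<open>u zero\<close> to \<open>infty\<close>, the conjugate form of
    \<open>g\<close> gives \<open>u zero = \<mu> y (ng b)\<close>, which specialness turns into
    \<open>ng a\<close>.\<close>
  have "\<alpha> (ng a) (g (u zero)) = \<alpha> (ng a) infty"
    using fun_cong[OF dec, of zero] U_fix[OF alpha(1)[of "ng a"]] mu_swap(1)[of "ng a"] a
    by (simp add: unit_neg)
  then have "g (u zero) = infty"
    using alpha_bij[of "ng a"] a by (metis finv_apply(1) neg_R unit_R)
  then have "\<mu> y (\<alpha> b (\<mu> (ng y) (u zero))) = \<mu> y zero"
    using y by (simp flip: g_eq)
  then have "\<alpha> b (\<mu> (ng y) (u zero)) = zero"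
    using mu_ng_inverse(1)[OF y] by metis
  then have "\<mu> (ng y) (u zero) = ng b"
    using alpha_bij[of b] b(1) unfolding neg_def[of _ _ _ b] by (metis finv_apply(1) unit_R)
  then have "u zero = ng a"
    using mu_ng[OF b(1) y] b(2) mu_ng_inverse(2)[OF y] by metis
  then have "u = \<alpha> (ng a)"
    using alpha_eqI[OF u] by simp
  then have "\<mu> (ng a) (\<alpha> a x) = \<alpha> (ng a) (g x)"
    using a dec alpha_bij[of a] by (simp add: alpha_neg)
  then have "\<alpha> a (\<mu> (ng a) (\<alpha> a x)) = g x"
    using a alpha_bij[of a] by (simp add: alpha_neg)
  then show ?thesis
    by (simp flip: g_eq add: b_def)
qed

text \<open>Take \<open>y = e\<close> in \<open>special_decomposition\<close>, once for
  \<open>a\<close> at \<open>b\<close> and once for \<open>b\<close> at \<open>a\<close>: the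
  left-hand sides are \<open>\<mu> e (d \<boxplus> c)\<close> and
  \<open>\<mu> e (c \<boxplus> d)\<close>, equal by commutativity.\<close>

lemma mu_exchange:
  assumes "unit a" "unit b" "unit (a \<boxplus> b)"
  shows "\<mu> (ng a) (a \<boxplus> b) \<boxplus> a = \<mu> (ng b) (a \<boxplus> b) \<boxplus> b"
proof -
  define c d where "c = \<mu> (ng e) a" and "d = \<mu> (ng e) b"
  have cd: "unit c" "unit d"
    using assms by (auto simp: c_def d_def mu_unit unit_neg)
  have "\<alpha> a (\<mu> (ng a) (b \<boxplus> a)) = \<mu> e (d \<boxplus> c)"
    using special_decomposition[of a e b] assms cd by (simp add: plus_alpha c_def d_def)
  moreover have "\<alpha> b (\<mu> (ng b) (a \<boxplus> b)) = \<mu> e (c \<boxplus> d)"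
    using special_decomposition[of b e a] assms cd by (simp add: plus_alpha c_def d_def)
  ultimately show ?thesis
    using assms cd plus_comm[of a b] plus_comm[of c d]
    by (simp add: plus_alpha[of "\<mu> _ _"] mu_unit unit_neg)
qed

text \<open>In \<open>special_decomposition\<close> with \<open>y = a\<close> and
  \<open>x = zero\<close>, the inner translation is evaluated at \<open>infty\<close>, which it
  fixes, so the left-hand side is \<open>zero\<close>.\<close>

lemma mu_ng_self:
  assumes "unit a"
  shows "\<mu> (ng a) a = ng a"
proof -
  have "\<alpha> a (\<mu> (ng a) (\<alpha> a zero)) = \<mu> a (\<alpha> (\<mu> (ng a) a) (\<mu> (ng a) zero))"
    using special_decomposition[of a a zero] assms by simp
  also have "\<dots> = zero"
    using assms U_fix[OF alpha(1)[of "\<mu> (ng a) a"]] by (simp add: unit_neg mu_unit)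
  finally have "\<alpha> a (\<mu> (ng a) a) = zero"
    using assms by (simp add: alpha)
  then show ?thesis
    using alpha_bij[of a] assms unfolding neg_def[of _ _ _ a]
    by (metis finv_apply(1) unit_R)
qed

lemma mu_self: "unit a \<Longrightarrow> \<mu> a a = ng a"
  using mu_ng_self[of "ng a"] mu_ng[of a a] mu_unit[of a a] unit_neg[of a]
  by (metis neg_neg unit_R)

section \<open>Unique halves\<close>

text \<open>Put both \<open>a\<close> and \<open>x\<close> equal to \<open>c\<close> in
  \<open>special_decomposition\<close>. Used with \<open>y\<close> it gives
  \<open>\<mu> y (b \<boxplus> b) = m \<boxplus> c\<close>, and with \<open>ng c\<close> in place of
  \<open>y\<close> it gives \<open>ng m = m \<boxplus> c\<close>. Hence the double of
  \<open>m \<boxplus> c\<close> is \<open>(m \<boxplus> c) \<boxplus> ng m = c\<close>.\<close>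

lemma double_mu:
  assumes b: "unit b" and y: "unit y"
  shows "\<mu> y (b \<boxplus> b) \<boxplus> \<mu> y (b \<boxplus> b) = \<mu> y b"
proof -
  define c where "c = \<mu> y b"
  have c: "unit c" "\<mu> (ng y) c = b"
    using b y by (auto simp: c_def mu_unit)
  define m where "m = \<mu> (ng c) (c \<boxplus> c)"
  have m: "unit m"
    using c R4 by (simp add: m_def mu_unit unit_neg)
  have "\<mu> y (b \<boxplus> b) = \<alpha> c m"
    using special_decomposition[OF c(1) y, of c] c b by (simp add: m_def plus_alpha)
  then have 1: "\<mu> y (b \<boxplus> b) = m \<boxplus> c"
    using m by (simp add: plus_alpha)
  have "ng c \<boxplus> ng c = ng (c \<boxplus> c)"
    using c(1) by (simp add: neg_plus diff_simps)
  then have "\<mu> (ng c) (ng c \<boxplus> ng c) = ng m"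
    using mu_ng[of "c \<boxplus> c" "ng c"] c(1) R4 by (simp add: m_def unit_neg)
  moreover have "\<mu> (ng c) (ng c \<boxplus> ng c) = \<alpha> c m"
    using special_decomposition[OF c(1) unit_neg[OF c(1)], of c] c(1)
    by (simp add: m_def plus_alpha mu_self)
  ultimately have "ng m = m \<boxplus> c"
    using m by (simp add: plus_alpha)
  then have "m \<boxplus> (m \<boxplus> c) = zero"
    using m c(1) by (simp add: diff_simps)
  then show ?thesis
    using m c(1) 1 plus_left_comm[of "m \<boxplus> c" m c] plus_assoc[of m c "m \<boxplus> c"]
      plus_assoc[of m "m \<boxplus> c" c] plus_comm[of c "m \<boxplus> c"]
    by (simp flip: c_def)
qed

text \<open>By \<open>R4\<close> the difference \<open>d\<close>, whose double is
  \<open>zero\<close>, is not a unit, so \<open>e \<boxplus> d\<close> is a unit with the same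
  double as \<open>e\<close>. But \<open>double_mu\<close> recovers a unit from its double.\<close>

lemma double_inj:
  assumes "x \<in> R" "y \<in> R" "x \<boxplus> x = y \<boxplus> y"
  shows "x = y"
proof -
  define d where "d = x \<boxminus> y"
  have d: "d \<in> R" "x = d \<boxplus> y"
    using assms minus_eq_iff[of x y d] by (auto simp: d_def)
  have "(d \<boxplus> d) \<boxplus> (y \<boxplus> y) = zero \<boxplus> (y \<boxplus> y)"
    using assms d by (simp add: plus_ac)
  then have dd: "d \<boxplus> d = zero"
    using assms d by (simp add: plus_cancel del: plus_zero)
  have "\<not> unit d"
    using R4[of d] dd by (auto simp: munit_def)
  then have u: "unit (e \<boxplus> d)"
    using d unit_plus_nonunit[of e d] by (simp add: unit_iff)
  have "(e \<boxplus> d) \<boxplus> (e \<boxplus> d) = (e \<boxplus> e) \<boxplus> (d \<boxplus> d)"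
    using d by (simp add: plus_ac)
  then have "(e \<boxplus> d) \<boxplus> (e \<boxplus> d) = e \<boxplus> e"
    using dd by simp
  then have "\<mu> e (e \<boxplus> d) = \<mu> e e"
    using double_mu[OF u e_unit] double_mu[of e e] by simp
  then have "e \<boxplus> d = e"
    using mu_ng_inverse(1)[OF e_unit] by metis
  then have "d = zero"
    using d plus_cancel[of d zero e] by (simp add: plus_comm)
  then show ?thesis
    using d assms by simp
qed

text \<open>The half of \<open>\<mu> e b\<close> is \<open>\<mu> e (b \<boxplus> b)\<close>; here
  \<open>b = \<mu> (ng e) z\<close>.\<close>

lemma double_ex_unit: "unit z \<Longrightarrow> \<exists>w\<in>R. w \<boxplus> w = z"
  using double_mu[of "\<mu> (ng e) z" e] mu_unit R4 unit_neg by (metis e_unit mu_ng_inverse(2) unit_R)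

lemma double_ex: 
  assumes "z \<in> R" 
  shows "\<exists>w\<in>R. w \<boxplus> w = z"
proof (cases "unit z")
  case False
  then have "unit (e \<boxplus> z)"
    using assms unit_plus_nonunit[of e z] by (simp add: unit_iff)
  \<comment> \<open>A nonunit \<open>z\<close> is the difference of the units
    \<open>e \<boxplus> z\<close> and \<open>e\<close>, so the difference of their halves is a half
    of \<open>z\<close>.\<close>
  then obtain v w where vw: "v \<in> R" "w \<in> R" "v \<boxplus> v = e \<boxplus> z" "w \<boxplus> w = e"
    using double_ex_unit e_unit by metis
  have "(v \<boxminus> w) \<boxplus> (v \<boxminus> w) = (v \<boxplus> v) \<boxminus> (w \<boxplus> w)"
    using vw(1,2) by (simp add: diff_simps)
  also have "\<dots> = z"
    using assms by (simp add: vw diff_simps plus_comm)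
  finally show ?thesis
    using vw by (intro bexI[of _ "v \<boxminus> w"]) auto
qed (rule double_ex_unit)

abbreviation "hf \<equiv> half sim U zero infty"

lemma half:
  assumes "z \<in> R"
  shows half_R [simp]: "hf z \<in> R" and half_double: "hf z \<boxplus> hf z = z"
proof -
  have "\<exists>!w. \<not> sim w infty \<and> w \<boxplus> w = z"
    using double_ex[OF assms] double_inj unfolding R_iff[symmetric] by metis
  from theI'[OF this] show "hf z \<in> R" "hf z \<boxplus> hf z = z"
    unfolding half_def R_iff by auto
qed

lemma half_eqI: "w \<in> R \<Longrightarrow> w \<boxplus> w = z \<Longrightarrow> hf z = w"
  using double_inj half half_R by (metis plus_R)

lemma half_nonunit: "sim z zero \<Longrightarrow> sim (hf z) zero"
  using R4[of "hf z"] half[of z] sim_R[of z zero] sim_unit[of z zero] unit_iff half_R[of z]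
  by auto

section \<open>The maps \<open>\<mu> b\<close> are involutions\<close>

lemma mu_comm:
  assumes "unit a" "unit b" "unit c" "unit d"
  shows "\<mu> a (\<mu> b (\<mu> c (\<mu> d x))) = \<mu> c (\<mu> d (\<mu> a (\<mu> b x)))"
proof -
  have "\<mu> a \<circ> \<mu> b \<in> hua sim U zero infty" "\<mu> c \<circ> \<mu> d \<in> hua sim U zero infty"
    unfolding hua_def using assms by (blast intro: gen_group_incl)+
  from R3[rule_format, OF this] show ?thesis
    by (simp add: fun_eq_iff)
qed

text \<open>The map \<open>z = \<mu> b \<circ> \<mu> b\<close> commutes with \<open>\<mu> a\<close>,
  so conjugating by \<open>z\<close> gives \<open>\<mu> (z a) = \<mu> a\<close>. In
  \<open>mu_exchange\<close> for \<open>a\<close> and \<open>z a\<close> both sides then have the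
  same first summand \<open>m\<close>, which cancels.\<close>

lemma mu_square_fix_aux:
  assumes a: "unit a" and b: "unit b"
    and u: "unit (a \<boxplus> \<mu> b (\<mu> b a))"
  shows "\<mu> b (\<mu> b a) = a"
proof -
  define z where "z = \<mu> b \<circ> \<mu> b"
  have z: "z \<in> torus"
    using mu_mu_torus[OF b b] by (simp add: z_def)
  \<comment> \<open>Only products of two \<open>\<mu>\<close>-maps are known to commute; a fourth
    factor \<open>\<mu> b\<close> is supplied and cancelled by evaluating at
    \<open>\<mu> (ng b) x\<close>.\<close>
  have "\<mu> a (z x) = z (\<mu> a x)" for x
    using mu_comm[OF a b b b, of "\<mu> (ng b) x"] b by (simp add: z_def)
  then have "\<mu> (z a) = \<mu> a"
    using mu_torus[OF z a] torusD(4)[OF z] by (auto simp: fun_eq_iff) (metis finv_apply(2))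
  then have mu_eq: "\<mu> (ng (z a)) = \<mu> (ng a)"
    using mu_neg a torus_unit[OF z] by metis
  have za: "unit (z a)" "unit (a \<boxplus> z a)"
    using a u torus_unit[OF z] by (simp_all add: z_def)
  define m where "m = \<mu> (ng a) (a \<boxplus> z a)"
  have "m \<boxplus> a = m \<boxplus> z a" and "unit m"
    using mu_exchange[OF a za] za(2) mu_unit unit_neg[OF a] by (auto simp: mu_eq m_def)
  then have "z a = a"
    using plus_cancel[of a "z a" m] plus_comm[of m] a za by simp
  then show ?thesis by (simp add: z_def)
qed

text \<open>The remaining case \<open>za \<sim> -a\<close> with \<open>z = \<mu>\<^sub>b\<^sup>2\<close> is impossible: \<open>z\<close> fixes \<open>\<plusminus>b\<close>, so for
  \<open>c = \<plusminus>b\<close> with \<open>a + c\<close> a unit, \<open>z(a + c) \<sim> -a + c\<close> would have to be equivalent to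
  \<open>\<plusminus>(a + c)\<close>.\<close>
lemma mu_square_fix:
  assumes a: "unit a" and b: "unit b"
  shows "\<mu> b (\<mu> b a) = a"
proof (cases "unit (a \<boxplus> \<mu> b (\<mu> b a))")
  case False
  define z where "z = \<mu> b \<circ> \<mu> b"
  have z: "z \<in> torus"
    using mu_mu_torus[OF b b] by (simp add: z_def)
  have za: "unit (z a)"
    using a torus_unit[OF z] by simp
  with False have anti: "sim (z a) (ng a)"
    using a plus_sim_zero[of "z a" a] by (simp add: unit_iff plus_comm z_def)
  have False if c: "unit c" "z c = c" and ac: "unit (a \<boxplus> c)" for c
  proof -
    have "z (a \<boxplus> c) = z a \<boxplus> c"
      using torus_add[OF z, of a c] a c by simp
    then have 1: "sim (z (a \<boxplus> c)) (ng a \<boxplus> c)"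
      using anti plus_sim[of "z a" "ng a" c] za a c by simp
    have zac: "unit (z (a \<boxplus> c))"
      using ac torus_unit[OF z] by blast
    show False
    proof (cases "unit ((a \<boxplus> c) \<boxplus> z (a \<boxplus> c))")
      case True
      then have "z (a \<boxplus> c) = a \<boxplus> c"
        using mu_square_fix_aux[OF ac b] by (simp add: z_def)
      then have "sim (a \<boxplus> c) (ng a \<boxplus> c)"
        using 1 by simp
      then have "sim (a \<boxplus> a) zero"
        using plus_sim[of a "ng a" c] plus_sim_zero[of a a] a c by simp
      then show False
        using R4[OF a] by (simp add: munit_def)
    next
      case False
      then have "sim (z (a \<boxplus> c)) (ng (a \<boxplus> c))"
        using plus_sim_zero[of "z (a \<boxplus> c)" "a \<boxplus> c"] zac ac a c
        by (simp add: unit_iff plus_comm)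
      then have "sim (ng a \<boxplus> c) (ng a \<boxplus> ng c)"
        using 1 sim_sym sim_trans a c by (metis neg_plus minus_def unit_R)
      then have "sim (c \<boxplus> c) zero"
        using plus_sim_right[of c "ng c" "ng a"] plus_sim_zero[of c c] a c by simp
      then show False
        using R4[OF c(1)] by (simp add: munit_def)
    qed
  qed
  note contra = this
  have zb: "z b = b" "z (ng b) = ng b"
    using b by (simp_all add: z_def mu_self mu_ng mu_unit unit_neg)
  show ?thesis
  proof (cases "unit (a \<boxplus> b)")
    case True
    then show ?thesis using contra[OF b zb(1)] by simp
  next
    case False
    then have "unit (a \<boxplus> ng b)"
      using unit_minus[OF a b] by (simp add: minus_def)
    then show ?thesis using contra[OF unit_neg[OF b] zb(2)] by simp
  qed
qed (rule mu_square_fix_aux[OF a b])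

text \<open>Units are covered by \<open>mu_square_fix\<close>. A nonunit \<open>x\<close> in
  \<open>R\<close> is reached through the units \<open>e \<boxplus> x\<close> and \<open>e\<close>,
  as the square is additive. Outside \<open>R\<close>, the square fixes \<open>\<mu> b x\<close>,
  which lies in \<open>R\<close>, and injectivity of \<open>\<mu> b\<close> gives the claim.\<close>

lemma mu_involution [simp]:
  assumes b: "unit b"
  shows "\<mu> b (\<mu> b x) = x"
proof -
  define z where "z = \<mu> b \<circ> \<mu> b"
  have z: "z \<in> torus"
    using mu_mu_torus[OF b b] by (simp add: z_def)
  have R: "z x = x" if x: "x \<in> R" for x
  proof (cases "unit x")
    case True
    then show ?thesis using mu_square_fix b by (simp add: z_def)
  next
    case False
    then have u: "unit (e \<boxplus> x)"
      using x unit_plus_nonunit[of e x] by (simp add: unit_iff)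
    have "e \<boxplus> z x = z (e \<boxplus> x)"
      using torus_add[OF z, of e x] x mu_square_fix[of e b] b by (simp add: z_def)
    also have "\<dots> = e \<boxplus> x"
      using mu_square_fix[OF u b] by (simp add: z_def)
    finally show ?thesis
      using x torus_R[OF z, of x] plus_cancel[of "z x" x e] by (simp add: plus_comm)
  qed
  show ?thesis
  proof (cases "x \<in> R")
    case True
    then show ?thesis using R by (simp add: z_def)
  next
    case False
    then have "\<not> sim (\<mu> b x) infty"
      using b mu_sim[of b x infty] mu_sim[of b infty "\<mu> b x"] mu_swap[OF b] basis R_iff
        sim_sym sim_trans by metis
    then have "z (\<mu> b x) = \<mu> b x"
      using R R_iff by blast
    then show ?thesis
      using mu_ng_inverse(1)[OF b] unfolding z_def o_apply by metis
  qed
qed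

lemma mu_ng_index: "unit b \<Longrightarrow> \<mu> (ng b) = \<mu> b"
  using mu_ng_inverse(1) by (metis ext mu_involution)

section \<open>The Hua maps and the value of \<open>Rop\<close> at \<open>e\<close>\<close>

text \<open>This is \<open>mu_exchange\<close> for \<open>ng y\<close> and
  \<open>c \<boxplus> y\<close>, whose sum is \<open>c\<close>; the sign of an index no longer
  matters.\<close>

lemma mu_shift:
  assumes "unit c" "unit y" "unit (c \<boxplus> y)"
  shows "\<mu> y c = \<mu> (c \<boxplus> y) c \<boxplus> (c \<boxplus> (y \<boxplus> y))"
proof -
  have "ng y \<boxplus> (c \<boxplus> y) = c"
    using assms by (simp add: diff_simps)
  then have "\<mu> y c \<boxplus> ng y = \<mu> (c \<boxplus> y) c \<boxplus> (c \<boxplus> y)"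
    using mu_exchange[of "ng y" "c \<boxplus> y"] assms by (simp add: unit_neg mu_ng_index)
  then show ?thesis
    using assms mu_unit by (simp add: diff_simps plus_ac)
qed

abbreviation "h \<equiv> hmap U zero infty e"

lemma h_apply: "h x y = \<mu> x (\<mu> e y)"
  by (simp add: hmap_def)

lemma h_torus: "unit x \<Longrightarrow> h x \<in> torus"
  unfolding hmap_def by (simp add: mu_mu_torus)

lemma h_e: "unit x \<Longrightarrow> h x e = ng (\<mu> x e)"
  by (simp add: h_apply mu_self mu_ng)

text \<open>As \<open>h u e = ng (\<mu> u e)\<close>, each case of \<open>Rop\<close> combines
  values \<open>\<mu> u e\<close>, and \<open>mu_shift\<close> gives their difference for indices
  that differ by \<open>e\<close>.\<close>

lemma Rop_e:
  assumes "y \<in> R"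
  shows "Rop sim U zero infty e y e = y \<boxplus> y"
proof -
  consider (1) "unit y" "unit (y \<boxplus> e)" | (2) "unit y" "\<not> unit (y \<boxplus> e)" | (3) "\<not> unit y"
    by blast
  then show ?thesis
  proof cases
    case 1
    then have u: "unit (e \<boxplus> y)"
      by (simp add: plus_comm)
    then show ?thesis
      using 1 assms mu_shift[of e y] mu_unit[of y e] mu_unit[of "e \<boxplus> y" e]
      by (simp add: Rop_def h_e diff_simps plus_ac)
  next
    case 2
    \<comment> \<open>Since \<open>y \<boxplus> e\<close> is not a unit, the shift runs from the
      index \<open>y \<boxminus> e\<close> up to \<open>y\<close>.\<close>
    then have "unit (y \<boxminus> e)"
      by (simp add: unit_minus)
    moreover have "e \<boxplus> (y \<boxminus> e) = y"
      using assms by (simp add: plus_minus minus_eq_iff plus_comm)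
    ultimately have "\<mu> (y \<boxminus> e) e = \<mu> y e \<boxplus> (e \<boxplus> ((y \<boxminus> e) \<boxplus> (y \<boxminus> e)))"
      using 2 mu_shift[of e "y \<boxminus> e"] by simp
    with \<open>unit (y \<boxminus> e)\<close> show ?thesis
      using 2 assms mu_unit[of y e] mu_unit[of "y \<boxminus> e" e]
      by (simp add: Rop_def h_e diff_simps plus_ac plus_cancel_left)
  next
    case 3
    then have u: "unit (e \<boxplus> y)" "unit ((e \<boxplus> e) \<boxplus> y)" 
      using assms unit_iff[of y] unit_plus_nonunit[of e y] unit_plus_nonunit[of "e \<boxplus> e" y]
        R4[of e] by auto
    define p q r where "p = \<mu> (e \<boxplus> y) e" and "q = \<mu> ((e \<boxplus> e) \<boxplus> y) e" and "r = \<mu> (e \<boxplus> e) e"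
    have R: "p \<in> R" "q \<in> R" "r \<in> R"
      using u mu_unit R4[of e] by (auto simp: p_def q_def r_def)
    \<comment> \<open>Shifting from \<open>e + y\<close> to \<open>2e + y\<close> and from
      \<open>e\<close> to \<open>2e\<close> gives \<open>p - q = 3e + 2y\<close> and
      \<open>r = -4e\<close>, so that \<open>p - q + r + e = 2y\<close>.\<close>
    have p: "p = q \<boxplus> (e \<boxplus> ((e \<boxplus> y) \<boxplus> (e \<boxplus> y)))"
      using mu_shift[of e "e \<boxplus> y"] u assms by (simp add: p_def q_def plus_assoc)
    have "r \<boxplus> (e \<boxplus> (e \<boxplus> e)) = ng e"
      using mu_shift[of e e] R4[of e] by (simp add: r_def mu_self)
    then have r: "e \<boxplus> (r \<boxplus> (e \<boxplus> (e \<boxplus> e))) = zero"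
      by (simp add: plus_neg)
    have "Rop sim U zero infty e y e = ((ng q \<boxminus> ng p) \<boxminus> ng r) \<boxplus> e"
      using 3 u by (simp add: Rop_def h_e R4 unit_neg mu_ng_index p_def q_def r_def)
    also have "\<dots> = (p \<boxplus> r \<boxplus> e) \<boxminus> q"
      using R by (simp add: diff_simps plus_ac)
    also have "p \<boxplus> r \<boxplus> e = (q \<boxplus> (y \<boxplus> y)) \<boxplus> (e \<boxplus> (r \<boxplus> (e \<boxplus> (e \<boxplus> e))))"
      using R(2,3) assms by (simp add: p plus_ac)
    also have "\<dots> \<boxminus> q = y \<boxplus> y"
      unfolding r using R assms by (simp add: minus_eq_iff plus_comm)
    finally show ?thesis .
  qed
qed

section \<open>The ring\<close>

definition additive :: "('a \<Rightarrow> 'a) \<Rightarrow> bool" where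
  "additive f \<longleftrightarrow> (\<forall>x\<in>R. f x \<in> R) \<and> (\<forall>x\<in>R. \<forall>y\<in>R. f (x \<boxplus> y) = f x \<boxplus> f y)"

lemma additiveD: "additive f \<Longrightarrow> x \<in> R \<Longrightarrow> f x \<in> R"
  "additive f \<Longrightarrow> x \<in> R \<Longrightarrow> y \<in> R \<Longrightarrow> f (x \<boxplus> y) = f x \<boxplus> f y"
  unfolding additive_def by blast+

lemma additive_zero: "additive f \<Longrightarrow> f zero = zero"
  using additiveD[of f zero] plus_cancel[of "f zero" zero "f zero"] by simp

lemma additive_neg: "additive f \<Longrightarrow> x \<in> R \<Longrightarrow> f (ng x) = ng (f x)"
  using additiveD(2)[of f x "ng x"] additive_zero[of f] additiveD(1)[of f] neg_eqI[of "f x" "f (ng x)"]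
  by (simp add: plus_neg)

lemma additive_half: "additive f \<Longrightarrow> x \<in> R \<Longrightarrow> f (hf x) = hf (f x)"
  using additiveD[of f "hf x"] additiveD(2)[of f "hf x" "hf x"] half[of x] half_eqI[of "f (hf x)" "f x"]
  by simp

lemma additive_plus: "additive f \<Longrightarrow> additive g \<Longrightarrow> additive (\<lambda>x. f x \<boxplus> g x)"
  unfolding additive_def by (auto simp: plus_ac)

lemma additive_uminus: "additive f \<Longrightarrow> additive (\<lambda>x. ng (f x))"
  unfolding additive_def by (auto simp: neg_plus minus_def)

lemma half_plus: "x \<in> R \<Longrightarrow> y \<in> R \<Longrightarrow> hf (x \<boxplus> y) = hf x \<boxplus> hf y"
proof (rule half_eqI)
  assume "x \<in> R" "y \<in> R"
  moreover from this have "hf x \<boxplus> hf y \<boxplus> (hf x \<boxplus> hf y) = (hf x \<boxplus> hf x) \<boxplus> (hf y \<boxplus> hf y)"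
    by (simp add: plus_ac)
  ultimately show "hf x \<boxplus> hf y \<boxplus> (hf x \<boxplus> hf y) = x \<boxplus> y"
    by (simp add: half_double)
qed simp

text \<open>The closure properties are those called for by the three formulas of \<open>Rop\<close>
  followed by \<open>half\<close>; additivity lets commutation be checked on the generators
  \<open>h u\<close> alone.\<close>

inductive_set hua_ring :: "('a \<Rightarrow> 'a) set" where
  hua_ring_h: "unit u \<Longrightarrow> h u \<in> hua_ring"
| hua_ring_id: "(\<lambda>x. x) \<in> hua_ring"
| hua_ring_plus: "f \<in> hua_ring \<Longrightarrow> g \<in> hua_ring \<Longrightarrow> (\<lambda>x. f x \<boxplus> g x) \<in> hua_ring"
| hua_ring_neg: "f \<in> hua_ring \<Longrightarrow> (\<lambda>x. ng (f x)) \<in> hua_ring"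
| hua_ring_half: "f \<in> hua_ring \<Longrightarrow> (\<lambda>x. hf (f x)) \<in> hua_ring"

lemma h_additive: "unit u \<Longrightarrow> additive (h u)"
  using torus_add[OF h_torus] torus_R[OF h_torus] unfolding additive_def by blast

lemma hua_ring_additive: "f \<in> hua_ring \<Longrightarrow> additive f"
proof (induction rule: hua_ring.induct)
  case (hua_ring_half f)
  then show ?case
    unfolding additive_def by (auto simp: half_plus)
qed (auto simp: h_additive additive_plus additive_uminus, simp add: additive_def)

text \<open>Applied to multiplication operators, this makes the class of \<open>zero\<close> absorb
  products.\<close>

lemma hua_ring_sim_zero:
  assumes "f \<in> hua_ring" and n: "sim n zero"
  shows "sim (f n) zero"
  using assms(1)
proof induction
  case (hua_ring_h u)
  then show ?case
    using n torus_sim[OF h_torus] by blast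
next
  case (hua_ring_plus f g)
  then have "f n \<in> R" "g n \<in> R"
    using sim_R[of _ zero] by auto
  then have "sim (f n \<boxplus> g n) (f n)"
    using plus_sim_right[of "g n" zero "f n"] hua_ring_plus by simp
  then show ?case
    using hua_ring_plus sim_trans by blast
next
  case (hua_ring_neg f)
  then show ?case
    using unit_neg[of "ng (f n)"] sim_R[of "f n" zero] unit_iff[of "f n"] unit_iff[of "ng (f n)"] by auto
qed (use n half_nonunit in auto)

lemma hua_ring_commute_aux:
  assumes "f \<in> hua_ring" and g: "additive g"
    and comm: "\<And>u x. unit u \<Longrightarrow> x \<in> R \<Longrightarrow> g (h u x) = h u (g x)" and x: "x \<in> R"
  shows "g (f x) = f (g x)"
  using assms(1)
proof induction
  case (hua_ring_plus f k)
  then show ?case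
    using additiveD(2)[OF g] additiveD(1)[OF hua_ring_additive] x by simp
next
  case (hua_ring_neg f)
  then show ?case
    using additive_neg[OF g] additiveD(1)[OF hua_ring_additive] x by simp
next
  case (hua_ring_half f)
  then show ?case
    using additive_half[OF g] additiveD(1)[OF hua_ring_additive] x by simp
qed (use comm x in auto)

text \<open>The auxiliary lemma is used twice: the maps \<open>h u\<close> commute with each other,
  hence each commutes with \<open>f\<close>, hence \<open>f\<close> commutes with
  \<open>g\<close>.\<close>

lemma hua_ring_commute:
  assumes f: "f \<in> hua_ring" and g: "g \<in> hua_ring" and x: "x \<in> R"
  shows "f (g x) = g (f x)"
proof -
  have "h u (h v y) = h v (h u y)" if "unit u" "unit v" for u v y
    unfolding h_apply by (rule mu_comm) (use that in auto)
  then have "h u (f y) = f (h u y)" if "unit u" "y \<in> R" for u y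
    using hua_ring_commute_aux[OF f h_additive, of u] that by metis
  then show ?thesis
    using hua_ring_commute_aux[OF g hua_ring_additive[OF f] _ x] by metis
qed

section \<open>Commutativity and associativity of the multiplication\<close>

abbreviation tms (infixl "\<bullet>" 70) where "x \<bullet> y \<equiv> rmult sim U zero infty e x y"

lemma rmult_hua_ring:
  assumes "y \<in> R"
  shows "(\<lambda>x. x \<bullet> y) \<in> hua_ring"
proof -
  have "unit (ng e \<boxplus> y)" if "unit y" "\<not> unit (y \<boxplus> e)"
    using that unit_minus[of y e] by (simp add: neg_plus_left)
  moreover have "unit (e \<boxplus> y)" "unit ((e \<boxplus> e) \<boxplus> y)" if "\<not> unit y"
    using that assms unit_iff[of y] unit_plus_nonunit[of e y] unit_plus_nonunit[of "e \<boxplus> e" y]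
      R4[of e] by auto
  moreover have "unit (ng (e \<boxplus> e))"
    by (simp add: R4 unit_neg)
  ultimately show ?thesis
    unfolding rmult_def Rop_def minus_def using assms plus_comm[of y e]
    by (cases "unit y"; cases "unit (e \<boxplus> y)") (auto intro!: hua_ring.intros)
qed

lemma rmult_R [simp]: "x \<in> R \<Longrightarrow> y \<in> R \<Longrightarrow> x \<bullet> y \<in> R"
  using additiveD(1)[OF hua_ring_additive[OF rmult_hua_ring]] by blast

lemma rmult_e: "y \<in> R \<Longrightarrow> e \<bullet> y = y"
  unfolding rmult_def by (rule half_eqI) (simp_all add: Rop_e)

text \<open>Multiplication by \<open>y\<close> itself lies in \<open>hua_ring\<close>, so the
  operators are linear. Taking a multiplication operator for \<open>f\<close> yields the next two
  lemmas: at \<open>e\<close> commutativity, at a general element associativity.\<close>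

lemma rmult_commute_hua_ring:
  "f \<in> hua_ring \<Longrightarrow> x \<in> R \<Longrightarrow> y \<in> R \<Longrightarrow> f x \<bullet> y = f (x \<bullet> y)"
  using hua_ring_commute[OF rmult_hua_ring, of y f x] by simp

lemma rmult_comm: "x \<in> R \<Longrightarrow> y \<in> R \<Longrightarrow> x \<bullet> y = y \<bullet> x"
  using rmult_commute_hua_ring[OF rmult_hua_ring[of x], of e y] by (simp add: rmult_e)

lemma rmult_assoc: "x \<in> R \<Longrightarrow> y \<in> R \<Longrightarrow> z \<in> R \<Longrightarrow> (x \<bullet> y) \<bullet> z = x \<bullet> (y \<bullet> z)"
  using rmult_commute_hua_ring[OF rmult_hua_ring[of z], of y x] rmult_comm[of x y]
    rmult_comm[of "y \<bullet> z" x] by simp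

lemma rmult_distrib: "x \<in> R \<Longrightarrow> y \<in> R \<Longrightarrow> z \<in> R \<Longrightarrow> (x \<boxplus> y) \<bullet> z = x \<bullet> z \<boxplus> y \<bullet> z"
  using additiveD(2)[OF hua_ring_additive[OF rmult_hua_ring]] by blast

lemma rmult_nonunit: "x \<in> R \<Longrightarrow> sim n zero \<Longrightarrow> sim (n \<bullet> x) zero"
  using hua_ring_sim_zero[OF rmult_hua_ring] by blast

section \<open>Squares and inverses\<close>

text \<open>The Hua maps \<open>\<mu> a \<circ> \<mu> b\<close> and
  \<open>\<mu> c \<circ> \<mu> b\<close> commute, and the surplus \<open>\<mu> b\<close> cancels by
  involutivity.\<close>

lemma mu_triple: "unit a \<Longrightarrow> unit b \<Longrightarrow> unit c \<Longrightarrow> \<mu> a (\<mu> b (\<mu> c x)) = \<mu> c (\<mu> b (\<mu> a x))"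
  using mu_comm[of a b c b "\<mu> b x"] by simp

text \<open>Apply \<open>h x\<close> to \<open>\<mu> e x = \<mu> (x \<boxplus> e) x \<boxplus> (x
  \<boxplus> (e \<boxplus> e))\<close>: the left side becomes \<open>ng x\<close>, and
  \<open>mu_triple\<close> turns the first summand into
  \<open>ng (h (x \<boxplus> e) x)\<close>.\<close>

lemma h_shift:
  assumes x: "unit x" and u: "unit (x \<boxplus> e)"
  shows "h (x \<boxplus> e) x = h x x \<boxplus> x \<boxplus> (h x e \<boxplus> h x e)"
proof -
  have "h x (\<mu> (x \<boxplus> e) x) = \<mu> (x \<boxplus> e) (\<mu> e (\<mu> x x))"
    using x u by (simp add: h_apply mu_triple)
  then have 1: "h x (\<mu> (x \<boxplus> e) x) = ng (h (x \<boxplus> e) x)"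
    using x u by (simp add: h_apply mu_self mu_ng mu_unit)
  have "h x (\<mu> e x) = ng x"
    using x by (simp add: h_apply mu_self)
  moreover have "\<mu> e x = \<mu> (x \<boxplus> e) x \<boxplus> (x \<boxplus> (e \<boxplus> e))"
    using mu_shift[OF x e_unit u] .
  ultimately have "ng x = ng (h (x \<boxplus> e) x) \<boxplus> (h x x \<boxplus> (h x e \<boxplus> h x e))"
    using additiveD(2)[OF h_additive[OF x]] x u mu_unit 1 by simp
  moreover have "h (x \<boxplus> e) x \<in> R" "h x x \<in> R" "h x e \<in> R"
    using x u mu_unit by (simp_all add: h_apply)
  ultimately show ?thesis
    using x by (simp add: diff_simps plus_ac)
qed

lemma square_eq_h_shift:
  assumes x: "unit x" and u: "unit (x \<boxplus> e)"
  shows "x \<bullet> x = h x e"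
  unfolding rmult_def
proof (rule half_eqI)
  have R: "h (x \<boxplus> e) x \<in> R" "h x x \<in> R" "h x e \<in> R"
    using x u mu_unit by (simp_all add: h_apply)
  have "Rop sim U zero infty e x x = (h (x \<boxplus> e) x \<boxminus> h x x) \<boxminus> x"
    using x u plus_comm[of x e] by (simp add: Rop_def)
  also have "\<dots> = h x e \<boxplus> h x e"
    using R x h_shift[OF x u] by (simp add: diff_simps plus_ac)
  finally show "h x e \<boxplus> h x e = Rop sim U zero infty e x x" ..
  show "h x e \<in> R" by (fact R)
qed

text \<open>Both sides are unchanged when \<open>x\<close> is replaced by \<open>ng x\<close>, and
  at least one of \<open>x \<boxplus> e\<close> and \<open>ng x \<boxplus> e\<close> is a
  unit.\<close>

lemma square_eq_h:
  assumes x: "unit x"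
  shows "x \<bullet> x = h x e"
proof (cases "unit (x \<boxplus> e)")
  case False
  then have "unit (ng x \<boxplus> e)"
    using x unit_minus[of e x] plus_comm[of x e] by (simp add: neg_plus_left)
  then have "ng x \<bullet> ng x = h (ng x) e"
    using square_eq_h_shift x unit_neg by blast
  moreover have "ng x \<bullet> ng x = x \<bullet> x"
    using x additive_neg[OF hua_ring_additive[OF rmult_hua_ring]] rmult_comm[of x "ng x"] by simp
  ultimately show ?thesis
    using x by (simp add: h_apply mu_ng_index)
qed (rule square_eq_h_shift[OF x])

lemma rmult_inverse:
  assumes x: "unit x"
  shows "\<mu> e (ng x) \<bullet> x = e"
proof -
  define w where "w = \<mu> e (ng x)"
  have w: "unit w" 
    using x by (simp add: w_def mu_unit unit_neg)
  \<comment> \<open>The two maps \<open>\<mu> e\<close> cancel, leaving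
    \<open>\<mu> x (ng x) = x\<close>.\<close>
  have "h x w = x"
    using x by (simp add: w_def h_apply) (simp add: mu_ng mu_self)
  then have "h x (w \<bullet> x) = h x e"
    using rmult_commute_hua_ring[OF hua_ring_h[OF x], of w x] x w square_eq_h[OF x] by simp
  then have "w \<bullet> x = e"
    using torusD(4)[OF h_torus[OF x]] by (metis finv_apply(1))
  then show ?thesis by (simp add: w_def)
qed

section \<open>The local ring \<open>K\<close>\<close>

abbreviation "K \<equiv> the_ring sim U zero infty e"

lemma K_simps [simp]: "carrier K = R" "mult K = rmult sim U zero infty e" "one K = e"
  "Ring.zero K = zero" "add K = plus U zero infty"
  by (simp_all add: the_ring_def)

lemma K_cring: "cring K"
proof (rule cringI)
  show "abelian_group K"
    by (rule abelian_groupI) (auto simp: plus_ac intro!: bexI[of _ "ng _"] plus_neg)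
  show "comm_monoid K"
    by (rule comm_monoidI) (auto simp: rmult_assoc rmult_e intro: rmult_comm)
qed (simp add: rmult_distrib)

lemma K_Units: "Units K = {x. unit x}"
proof (intro equalityI subsetI)
  fix x assume "x \<in> Units K"
  then have "x \<in> R \<and> (\<exists>y\<in>R. y \<bullet> x = e \<and> x \<bullet> y = e)"
    unfolding Units_def K_simps by (rule CollectD)
  then obtain y where y: "x \<in> R" "y \<in> R" "x \<bullet> y = e"
    by blast
  \<comment> \<open>Otherwise the product \<open>e\<close> would be equivalent to
    \<open>zero\<close>.\<close>
  then have "\<not> sim x zero"
    using rmult_nonunit[of y x] e_unit unfolding munit_def by metis
  then show "x \<in> {x. unit x}"
    using y unit_iff by blast
next
  fix x assume "x \<in> {x. unit x}"
  then have x: "unit x" by simp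
  have w: "\<mu> e (ng x) \<in> R"
    using mu_unit[of e "ng x"] unit_neg[OF x] by simp
  have "x \<bullet> \<mu> e (ng x) = e"
    using rmult_inverse[OF x] rmult_comm[OF unit_R[OF x] w] by simp
  then show "x \<in> Units K"
    unfolding Units_def K_simps using x w rmult_inverse[OF x] unit_R by blast
qed

lemma K_inv:
  assumes "unit x"
  shows "inv\<^bsub>K\<^esub> x = \<mu> e (ng x)"
proof -
  interpret cring K by (rule K_cring)
  show ?thesis
    using assms rmult_inverse[of x] rmult_comm[of x "\<mu> e (ng x)"] mu_unit[of e "ng x"] unit_neg[of x]
    by (intro inv_char) auto
qed

lemma mcls_zero: "x \<in> mcls sim zero \<longleftrightarrow> x \<in> R \<and> \<not> unit x"
  unfolding mcls_def mem_Collect_eq by (metis sim_R sim_sym unit_iff zero_R)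

lemma K_local: "local_ring_with_max K (mcls sim zero)"
proof -
  interpret cring K by (rule K_cring)
  have proper: "I = R" if "ideal I K" "x \<in> I" "unit x" for I x
  proof -
    interpret I: ideal I K by fact
    have "e \<in> I"
      using I.I_l_closed[of x "\<mu> e (ng x)"] that rmult_inverse[of x] mu_unit[of e "ng x"] unit_neg[of x]
      by simp
    then show ?thesis
      using I.one_imp_carrier by simp
  qed
  have id: "ideal (mcls sim zero) K"
  proof (rule idealI)
    have neg: "\<ominus>\<^bsub>K\<^esub> x = ng x" if "x \<in> R" for x
      using that minus_equality[of "ng x" x] by (simp add: plus_neg_left)
    show "subgroup (mcls sim zero) (add_monoid K)"
    proof (rule subgroup.intro)
      show "mcls sim zero \<subseteq> carrier (add_monoid K)"
        by (auto simp: mcls_zero)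
      show "x \<otimes>\<^bsub>add_monoid K\<^esub> y \<in> mcls sim zero" if "x \<in> mcls sim zero" "y \<in> mcls sim zero" for x y
      proof -
        have "sim y zero" "sim x zero" "x \<in> R" "y \<in> R"
          using that by (auto simp: mcls_zero unit_iff)
        then have "sim (x \<boxplus> y) zero"
          using plus_sim_right[of y zero x] sim_trans[of "x \<boxplus> y" x zero] by simp
        then show ?thesis
          using \<open>x \<in> R\<close> \<open>y \<in> R\<close> by (simp add: mcls_zero unit_iff)
      qed
      show "\<one>\<^bsub>add_monoid K\<^esub> \<in> mcls sim zero"
        by (simp add: mcls_def)
      show "inv\<^bsub>add_monoid K\<^esub> x \<in> mcls sim zero" if "x \<in> mcls sim zero" for x
        using that unit_neg[of "ng x"] neg[of x] by (auto simp: mcls_zero a_inv_def)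
    qed
    fix a x assume "a \<in> mcls sim zero" "x \<in> carrier K"
    then show "a \<otimes>\<^bsub>K\<^esub> x \<in> mcls sim zero" "x \<otimes>\<^bsub>K\<^esub> a \<in> mcls sim zero"
      using rmult_nonunit[of x a] rmult_comm[of a x] by (auto simp: mcls_zero unit_iff)
  qed (rule K_cring[THEN cring.axioms(1)])
  moreover have "carrier K \<noteq> mcls sim zero"
    using e_unit mcls_zero by fastforce
  ultimately have max: "maximalideal (mcls sim zero) K"
  proof (rule maximalidealI)
    fix J assume J: "ideal J K" "mcls sim zero \<subseteq> J" "J \<subseteq> carrier K"
    show "J = mcls sim zero \<or> J = carrier K"
      using J proper[OF J(1)] by (auto simp: mcls_zero)
  qed
  have uniq: "I = mcls sim zero" if I: "maximalideal I K" for I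
  proof -
    interpret I: maximalideal I K by fact
    \<comment> \<open>A proper ideal contains no unit of the Moufang set, so it consists of
      nonunits; maximality of \<open>I\<close> then leaves only equality.\<close>
    have "I \<subseteq> mcls sim zero"
    proof
      fix x assume "x \<in> I"
      then show "x \<in> mcls sim zero"
        using I.I_notcarr I.a_subset proper[OF I.is_ideal, of x] unfolding mcls_zero K_simps by blast
    qed
    moreover have "mcls sim zero \<subseteq> carrier K"
      using mcls_zero unfolding K_simps by blast
    ultimately show ?thesis
      using I.I_maximal[OF id] maximalideal.I_notcarr[OF max] by metis
  qed
  show ?thesis
    unfolding local_ring_with_max_def by (intro conjI K_cring max allI impI) (rule uniq)
qed

end

theorem mainTheorem18:
  fixes sim :: "'a \<Rightarrow> 'a \<Rightarrow> bool" and U :: "'a \<Rightarrow> ('a \<Rightarrow> 'a) set"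
    and zero infty e :: 'a
  assumes LM: "local_moufang_set sim U"
    and basis: "\<not> sim zero infty"
    and R1: "special sim U zero infty"
    and R2: "\<forall>f\<in>U infty. \<forall>g\<in>U infty. f \<circ> g = g \<circ> f"
    and R3: "\<forall>f\<in>hua sim U zero infty. \<forall>g\<in>hua sim U zero infty. f \<circ> g = g \<circ> f"
    and R4: "\<forall>x. munit sim zero infty x \<longrightarrow> munit sim zero infty (plus U zero infty x x)"
    and e_unit: "munit sim zero infty e"
  shows "cring (the_ring sim U zero infty e)
    \<and> \<one>\<^bsub>the_ring sim U zero infty e\<^esub> = e
    \<and> local_ring_with_max (the_ring sim U zero infty e) (mcls sim zero)
    \<and> Units (the_ring sim U zero infty e) = {x. munit sim zero infty x}
    \<and> (\<forall>x. munit sim zero infty x \<longrightarrow>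
          inv\<^bsub>the_ring sim U zero infty e\<^esub> x = mu U zero infty e (neg U zero infty x))
    \<and> plus U zero infty e e \<in> Units (the_ring sim U zero infty e)"
proof -
  interpret commutative_moufang sim U zero infty e
    by unfold_locales (use assms in auto)
  show ?thesis
    using K_cring K_local K_Units K_inv R4[OF e_unit] by simp
qed

end
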